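(* Let $(X_n)_{n\ge0}$ be Markov chains on $(\mathbb S_n)_{n\ge0}$ with rates $(c_n)$ and down-operators $(D_n)$ satisfying (A0)--(A5) of the context, let $E,\iota,(d^o_s)_{s\in\mathbb S}$ satisfy (L1)--(L3) of the context, and suppose $c_n\to\infty$. Let $(\mathcal T(t))_{t\ge0}$ be the limiting Feller semigroup on $C(E)$ and $\mathcal A$ its generator (see context). For $n\ge0$ let $A_n=c_n(T_n-I)$ and let $K_n:C(\mathbb S_n)\to C(E)$ be given by $K_nf=\sum_{u\in\mathbb S_n}f(u)\,d^o_u$. Then for every $n\ge0$: (i) $\mathcal AK_n=K_nA_n$; (ii) $\mathcal T(t)K_n=K_ne^{tA_n}$ for $t\ge0$; (iii) the generator $\mathcal A$ can also be described by the formula $$\mathcal Ad^o_s=-c_{|s|-1}\Big(d^o_s-\sum_{|r|=|s|-1}d^o_r\,p^\uparrow_{|r|}(r,s)\Big),\qquad s\in\mathbb S.$$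
   Context: $C(Z)$: continuous real functions on $Z$ with the sup norm (all functions if $Z$ finite). A transition operator from $C(Z')$ to $C(Z)$ ($Z,Z'$ finite) is a map $f\mapsto\sum_{y\in Z'}\mu(\cdot,y)f(y)$ with $\mu$ a stochastic $Z\times Z'$ matrix. $\mathbb S=\bigcup_n\mathbb S_n$; $|s|$ is the $n$ with $s\in\mathbb S_n$; $\mathbf 1_u$ is the indicator of $\{u\}$; $c_{-1}=0$; $(f)_n=f|_{\mathbb S_n}$; empty sums are $0$. (A0) $\mathbb S_0,\mathbb S_1,\dots$ are finite and pairwise disjoint and $\mathbb S_0=\{\varnothing\}$. $T_n$ is the transition operator of the Markov chain $X_n$ on $\mathbb S_n$, $A_n=c_n(T_n-I)$, $(D_n)_{n\ge1}$ are linear operators, and for all $n\ge0$: (A1) $0<c_n<c_{n+1}$; (A2) $D_{n+1}$ is a transition operator from $C(\mathbb S_n)$ to $C(\mathbb S_{n+1})$; (A3) $\operatorname{range}(A_{n+1}+c_nI)\subset\operatorname{range}D_{n+1}$; (A4) $D_{n+1}$ is injective; (A5) $A_{n+1}D_{n+1}=D_{n+1}A_n$. $U_n:C(\mathbb S_{n+1})\to C(\mathbb S_n)$ is the unique linear operator with $c_nD_{n+1}U_n=A_{n+1}+c_nI$; $p^\uparrow_n(s,u)=(U_n\mathbf 1_u)(s)$ and $p^\uparrow_{k,n}(s,u)=(U_k\cdots U_{n-1}\mathbf 1_u)(s)$. $d_s(u)=(D_{|u|}\cdots D_{|s|+1}\mathbf 1_s)(u)$ if $|u|\ge|s|$ ($=\mathbf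 1_s(u)$ if $|u|=|s|$), else $0$. $\eta_{i,j}=\prod_{m=i}^{j-1}\frac{c_m}{c_{m-1}-c_{j-1}}$. $E$ is a compact metric space, $\iota:\mathbb S\to E$ a map, $d^o_s\in C(E)$, and: (L1) for every $x\in E$ there are $s_n\in\mathbb S_n$ with $\iota(s_n)\to x$; (L2) $\operatorname{span}\{d^o_s\}$ is dense in $C(E)$; (L3) $\|(d_s)_n-d^o_s\circ\iota|_{\mathbb S_n}\|_{C(\mathbb S_n)}\to0$ for each $s$. $h^o_s=\sum_{|r|\le|s|}p^\uparrow_{|r|,|s|}(r,s)\eta_{|r|,|s|}d^o_r$. Limiting semigroup: it is known that when $c_n\to\infty$ there is a unique Feller semigroup $(\mathcal T(t))$ on $C(E)$ with $\|T_n^{\lfloor c_nt\rfloor}(f\circ\iota|_{\mathbb S_n})-(\mathcal T(t)f)\circ\iota|_{\mathbb S_n}\|_{C(\mathbb S_n)}\to0$ for all $f\in C(E)$, $t\ge0$; it satisfies $\mathcal T(t)h^o_s=e^{-tc_{|s|-1}}h^o_s$ and its generator $\mathcal A$ has $\operatorname{span}\{d^o_s\}_{s\in\mathbb S}$ as a core, with $\mathcal Ah^o_s=-c_{|s|-1}h^o_s$. *)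

theory Defs
  imports "HOL-Analysis.Analysis"
begin

section \<open>Function spaces on finite sets and operators between them\<close>

text \<open>
  For finite \<open>Z\<close>, the space \<open>C(Z)\<close> is represented by the functions on the ambient type that
  vanish off \<open>Z\<close>. Operators are only ever constrained, and only ever used, on these spaces.
\<close>

definition CF :: "'s set \<Rightarrow> ('s \<Rightarrow> real) set" where
  "CF Z = {f. \<forall>s. s \<notin> Z \<longrightarrow> f s = 0}"

definition restr :: "'s set \<Rightarrow> ('s \<Rightarrow> real) \<Rightarrow> 's \<Rightarrow> real" where
  "restr Z f = (\<lambda>s. if s \<in> Z then f s else 0)"

definition sup_norm :: "'s set \<Rightarrow> ('s \<Rightarrow> real) \<Rightarrow> real" where
  "sup_norm Z f = (SUP s\<in>Z. \<bar>f s\<bar>)"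

definition stochastic :: "'s set \<Rightarrow> 's set \<Rightarrow> ('s \<Rightarrow> 's \<Rightarrow> real) \<Rightarrow> bool" where
  "stochastic Z Z' \<mu> \<longleftrightarrow>
     (\<forall>x\<in>Z. \<forall>y\<in>Z'. 0 \<le> \<mu> x y) \<and> (\<forall>x\<in>Z. (\<Sum>y\<in>Z'. \<mu> x y) = 1)"

definition matrix_op ::
    "'s set \<Rightarrow> 's set \<Rightarrow> ('s \<Rightarrow> 's \<Rightarrow> real) \<Rightarrow> ('s \<Rightarrow> real) \<Rightarrow> 's \<Rightarrow> real" where
  "matrix_op Z Z' \<mu> f = restr Z (\<lambda>x. \<Sum>y\<in>Z'. \<mu> x y * f y)"

text \<open>A transition operator from \<open>C(Z')\<close> to \<open>C(Z)\<close>; note the order of the set arguments.\<close>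

definition transition_operator ::
    "'s set \<Rightarrow> 's set \<Rightarrow> (('s \<Rightarrow> real) \<Rightarrow> 's \<Rightarrow> real) \<Rightarrow> bool" where
  "transition_operator Z Z' L \<longleftrightarrow>
     (\<exists>\<mu>. stochastic Z Z' \<mu> \<and> (\<forall>f\<in>CF Z'. L f = matrix_op Z Z' \<mu> f))"

definition linear_op_on :: "'s set \<Rightarrow> (('s \<Rightarrow> real) \<Rightarrow> 's \<Rightarrow> real) \<Rightarrow> bool" where
  "linear_op_on Z L \<longleftrightarrow>
     (\<forall>f\<in>CF Z. \<forall>g\<in>CF Z. \<forall>a b.
        L (\<lambda>s. a * f s + b * g s) = (\<lambda>s. a * L f s + b * L g s))"

text \<open>
  The exponential series of an operator. On \<open>C(Z)\<close> with \<open>Z\<close> finite, pointwise convergence is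
  convergence in the sup norm.
\<close>

definition op_exp :: "(('s \<Rightarrow> real) \<Rightarrow> 's \<Rightarrow> real) \<Rightarrow> ('s \<Rightarrow> real) \<Rightarrow> 's \<Rightarrow> real" where
  "op_exp L f = (\<lambda>s. \<Sum>k. (L ^^ k) f s / fact k)"

section \<open>The graded system of Markov chains\<close>

text \<open>
  \<open>S n\<close> are the levels, \<open>P n\<close> is the transition matrix of the \<open>n\<close>-th chain, \<open>c n\<close> its rate,
  and \<open>D n\<close> (for \<open>n \<ge> 1\<close>) the down-operator from \<open>C(S (n-1))\<close> to \<open>C(S n)\<close>.
\<close>

definition lev :: "(nat \<Rightarrow> 's set) \<Rightarrow> 's \<Rightarrow> nat" where
  "lev S s = (THE n. s \<in> S n)"

text \<open>The rates indexed by integers, so that \<open>c\<close> at \<open>-1\<close> is \<open>0\<close>.\<close>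

definition rate :: "(nat \<Rightarrow> real) \<Rightarrow> int \<Rightarrow> real" where
  "rate c k = (if k < 0 then 0 else c (nat k))"

definition chain_T ::
    "(nat \<Rightarrow> 's set) \<Rightarrow> (nat \<Rightarrow> 's \<Rightarrow> 's \<Rightarrow> real) \<Rightarrow> nat \<Rightarrow> ('s \<Rightarrow> real) \<Rightarrow> 's \<Rightarrow> real" where
  "chain_T S P n = matrix_op (S n) (S n) (P n)"

definition chain_A ::
    "(nat \<Rightarrow> 's set) \<Rightarrow> (nat \<Rightarrow> 's \<Rightarrow> 's \<Rightarrow> real) \<Rightarrow> (nat \<Rightarrow> real) \<Rightarrow>
     nat \<Rightarrow> ('s \<Rightarrow> real) \<Rightarrow> 's \<Rightarrow> real" where
  "chain_A S P c n f = (\<lambda>s. c n * (chain_T S P n f s - f s))"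

text \<open>
  The up-operator \<open>U n : C(S (n+1)) \<rightarrow> C(S n)\<close>. Taking it extensional on \<open>C(S (n+1))\<close>
  makes it unique as a HOL function (see lemma \<open>ex1_up_U\<close> below).
\<close>

definition is_up_U ::
    "(nat \<Rightarrow> 's set) \<Rightarrow> (nat \<Rightarrow> 's \<Rightarrow> 's \<Rightarrow> real) \<Rightarrow> (nat \<Rightarrow> real) \<Rightarrow>
     (nat \<Rightarrow> ('s \<Rightarrow> real) \<Rightarrow> 's \<Rightarrow> real) \<Rightarrow> nat \<Rightarrow> (('s \<Rightarrow> real) \<Rightarrow> 's \<Rightarrow> real) \<Rightarrow> bool" where
  "is_up_U S P c D n U \<longleftrightarrow>
     U \<in> CF (S (Suc n)) \<rightarrow>\<^sub>E CF (S n) \<and> linear_op_on (S (Suc n)) U \<and>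
     (\<forall>f\<in>CF (S (Suc n)).
        (\<lambda>s. c n * D (Suc n) (U f) s) = (\<lambda>s. chain_A S P c (Suc n) f s + c n * f s))"

definition up_U ::
    "(nat \<Rightarrow> 's set) \<Rightarrow> (nat \<Rightarrow> 's \<Rightarrow> 's \<Rightarrow> real) \<Rightarrow> (nat \<Rightarrow> real) \<Rightarrow>
     (nat \<Rightarrow> ('s \<Rightarrow> real) \<Rightarrow> 's \<Rightarrow> real) \<Rightarrow> nat \<Rightarrow> ('s \<Rightarrow> real) \<Rightarrow> 's \<Rightarrow> real" where
  "up_U S P c D n = (THE U. is_up_U S P c D n U)"

definition p_up ::
    "(nat \<Rightarrow> 's set) \<Rightarrow> (nat \<Rightarrow> 's \<Rightarrow> 's \<Rightarrow> real) \<Rightarrow> (nat \<Rightarrow> real) \<Rightarrow>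
     (nat \<Rightarrow> ('s \<Rightarrow> real) \<Rightarrow> 's \<Rightarrow> real) \<Rightarrow> nat \<Rightarrow> 's \<Rightarrow> 's \<Rightarrow> real" where
  "p_up S P c D n s u = up_U S P c D n (indicat_real {u}) s"

text \<open>\<open>D_comp D k j = D (k+j) \<circ> \<dots> \<circ> D (k+1)\<close>, the identity for \<open>j = 0\<close>.\<close>

primrec D_comp ::
    "(nat \<Rightarrow> ('s \<Rightarrow> real) \<Rightarrow> 's \<Rightarrow> real) \<Rightarrow> nat \<Rightarrow> nat \<Rightarrow> ('s \<Rightarrow> real) \<Rightarrow> 's \<Rightarrow> real" where
  "D_comp D k 0 f = f"
| "D_comp D k (Suc j) f = D (Suc (k + j)) (D_comp D k j f)"

definition d_fun ::
    "(nat \<Rightarrow> 's set) \<Rightarrow> (nat \<Rightarrow> ('s \<Rightarrow> real) \<Rightarrow> 's \<Rightarrow> real) \<Rightarrow> 's \<Rightarrow> 's \<Rightarrow> real" where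
  "d_fun S D s u =
     (if lev S s \<le> lev S u
      then D_comp D (lev S s) (lev S u - lev S s) (indicat_real {s}) u else 0)"

definition K_op ::
    "(nat \<Rightarrow> 's set) \<Rightarrow> ('s \<Rightarrow> 'v::real_vector) \<Rightarrow> nat \<Rightarrow> ('s \<Rightarrow> real) \<Rightarrow> 'v" where
  "K_op S dlim n f = (\<Sum>u\<in>S n. f u *\<^sub>R dlim u)"

section \<open>Feller semigroups and their generators\<close>

text \<open>
  For a compact metric space \<open>E\<close> (the universe of the type \<open>'e\<close>), \<open>C(E)\<close> is the type of
  bounded continuous functions. Semigroups are indexed by \<open>real\<close>, but only times \<open>t \<ge> 0\<close>
  are relevant. Conservativity is not included in the definition; for the limiting semigroup
  below it follows from the convergence.
\<close>

definition feller_semigroup ::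
    "(real \<Rightarrow> ('e::metric_space \<Rightarrow>\<^sub>C real) \<Rightarrow> ('e \<Rightarrow>\<^sub>C real)) \<Rightarrow> bool" where
  "feller_semigroup \<T> \<longleftrightarrow>
     (\<forall>t\<ge>0. linear (\<T> t)) \<and>
     (\<forall>t\<ge>0. \<forall>f. norm (\<T> t f) \<le> norm f) \<and>
     (\<forall>t\<ge>0. \<forall>f. (\<forall>x. 0 \<le> apply_bcontfun f x) \<longrightarrow> (\<forall>x. 0 \<le> apply_bcontfun (\<T> t f) x)) \<and>
     (\<forall>f. \<T> 0 f = f) \<and>
     (\<forall>s\<ge>0. \<forall>t\<ge>0. \<forall>f. \<T> (s + t) f = \<T> s (\<T> t f)) \<and>
     (\<forall>f. ((\<lambda>t. \<T> t f) \<longlongrightarrow> f) (at_right 0))"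

definition gen_domain :: "(real \<Rightarrow> 'v \<Rightarrow> 'v::real_normed_vector) \<Rightarrow> 'v set" where
  "gen_domain \<T> = {f. \<exists>g. ((\<lambda>t. (\<T> t f - f) /\<^sub>R t) \<longlongrightarrow> g) (at_right 0)}"

definition generator :: "(real \<Rightarrow> 'v \<Rightarrow> 'v::real_normed_vector) \<Rightarrow> 'v \<Rightarrow> 'v" where
  "generator \<T> f = Lim (at_right 0) (\<lambda>t. (\<T> t f - f) /\<^sub>R t)"

definition limiting_feller_semigroup ::
    "(nat \<Rightarrow> 's set) \<Rightarrow> (nat \<Rightarrow> 's \<Rightarrow> 's \<Rightarrow> real) \<Rightarrow> (nat \<Rightarrow> real) \<Rightarrow> ('s \<Rightarrow> 'e::metric_space) \<Rightarrow>
     (real \<Rightarrow> ('e \<Rightarrow>\<^sub>C real) \<Rightarrow> ('e \<Rightarrow>\<^sub>C real)) \<Rightarrow> bool" where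
  "limiting_feller_semigroup S P c \<iota> \<T> \<longleftrightarrow>
     feller_semigroup \<T> \<and>
     (\<forall>f. \<forall>t\<ge>0.
        (\<lambda>n. sup_norm (S n) (\<lambda>s.
           (chain_T S P n ^^ nat \<lfloor>c n * t\<rfloor>) (restr (S n) (apply_bcontfun f \<circ> \<iota>)) s
           - apply_bcontfun (\<T> t f) (\<iota> s))) \<longlonglongrightarrow> 0)"

section \<open>Well-definedness of the up-operators\<close>

lemma ex1_up_U:
  assumes fin: "finite (S n)" "finite (S (Suc n))" and c: "0 < c n"
    and D: "transition_operator (S (Suc n)) (S n) (D (Suc n))"
    and rng: "(\<lambda>f s. chain_A S P c (Suc n) f s + c n * f s) ` CF (S (Suc n))
              \<subseteq> D (Suc n) ` CF (S n)"
    and inj: "inj_on (D (Suc n)) (CF (S n))"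
  shows "\<exists>!U. is_up_U S P c D n U"
proof -
  let ?F = "CF (S (Suc n))" and ?G = "CF (S n)" and ?D = "D (Suc n)"
  let ?B = "\<lambda>f s. chain_A S P c (Suc n) f s + c n * f s"
  obtain \<mu> where \<mu>: "\<And>f. f \<in> ?G \<Longrightarrow> ?D f = matrix_op (S (Suc n)) (S n) \<mu> f"
    using D by (auto simp: transition_operator_def)
  have lin_in: "(\<lambda>s. a * f s + b * g s) \<in> CF Z" if "f \<in> CF Z" "g \<in> CF Z"
    for a b f g and Z :: "'a set"
    using that by (auto simp: CF_def)
  have Dlin: "?D (\<lambda>s. a * f s + b * g s) = (\<lambda>s. a * ?D f s + b * ?D g s)"
    if "f \<in> ?G" "g \<in> ?G" for a b f g
    using that lin_in[OF that]
    by (auto simp: \<mu> matrix_op_def restr_def fun_eq_iff sum.distrib sum_distrib_left algebra_simps)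
  have Blin: "?B (\<lambda>s. a * f s + b * g s) = (\<lambda>s. a * ?B f s + b * ?B g s)" for a b f g
    by (auto simp: chain_A_def chain_T_def matrix_op_def restr_def fun_eq_iff sum.distrib
        sum_distrib_left algebra_simps)
  have ex: "\<exists>g\<in>?G. (\<lambda>s. c n * ?D g s) = ?B f" if "f \<in> ?F" for f
  proof -
    have "?B f \<in> ?D ` ?G" using rng that by blast
    then obtain g where g2: "?B f = ?D g" and g1: "g \<in> ?G" by (rule imageE)
    let ?g = "\<lambda>s. (1 / c n) * g s + 0 * g s"
    have "?D ?g = (\<lambda>s. (1 / c n) * ?D g s + 0 * ?D g s)"
      using g1 by (intro Dlin)
    then have "(\<lambda>s. c n * ?D ?g s) = ?D g"
      using c by simp
    moreover have "?g \<in> ?G" using g1 by (intro lin_in)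
    ultimately show ?thesis unfolding g2 by blast
  qed
  have un: "g = h" if "g \<in> ?G" "h \<in> ?G" "(\<lambda>s. c n * ?D g s) = (\<lambda>s. c n * ?D h s)" for g h
    using that c inj by (auto simp: inj_on_def fun_eq_iff)
  define U where "U = (\<lambda>f\<in>?F. SOME g. g \<in> ?G \<and> (\<lambda>s. c n * ?D g s) = ?B f)"
  have U: "U f \<in> ?G \<and> (\<lambda>s. c n * ?D (U f) s) = ?B f" if "f \<in> ?F" for f
    unfolding U_def using someI_ex[of "\<lambda>g. g \<in> ?G \<and> (\<lambda>s. c n * ?D g s) = ?B f"] ex[OF that] that
    by auto
  have "linear_op_on (S (Suc n)) U"
    unfolding linear_op_on_def
  proof (intro ballI allI)
    fix f g a b assume fg: "f \<in> ?F" "g \<in> ?F"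
    have h: "(\<lambda>s. a * f s + b * g s) \<in> ?F" using lin_in fg by blast
    have "(\<lambda>s. c n * ?D (\<lambda>s. a * U f s + b * U g s) s) = ?B (\<lambda>s. a * f s + b * g s)"
    proof -
      have "(\<lambda>s. c n * ?D (\<lambda>s. a * U f s + b * U g s) s) =
          (\<lambda>s. a * (c n * ?D (U f) s) + b * (c n * ?D (U g) s))"
        using Dlin[of "U f" "U g" a b] U[OF fg(1)] U[OF fg(2)] by (simp add: algebra_simps)
      also have "\<dots> = (\<lambda>s. a * ?B f s + b * ?B g s)"
      proof -
        have "c n * ?D (U f) s = ?B f s" "c n * ?D (U g) s = ?B g s" for s
          using U[OF fg(1)] U[OF fg(2)] by (auto dest: fun_cong)
        then show ?thesis by simp
      qed
      also have "\<dots> = ?B (\<lambda>s. a * f s + b * g s)"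
        by (rule Blin[symmetric])
      finally show ?thesis .
    qed
    note eq = this
    have mem: "(\<lambda>s. a * U f s + b * U g s) \<in> ?G"
      using U[OF fg(1)] U[OF fg(2)] by (intro lin_in) (rule conjunct1, assumption)+
    show "U (\<lambda>s. a * f s + b * g s) = (\<lambda>s. a * U f s + b * U g s)"
      by (rule un[OF conjunct1[OF U[OF h]] mem trans[OF conjunct2[OF U[OF h]] eq[symmetric]]])
  qed
  then have "is_up_U S P c D n U"
    unfolding is_up_U_def using U by (auto simp: U_def)
  moreover have "V = U" if V: "is_up_U S P c D n V" for V
  proof (rule PiE_ext)
    show "V \<in> ?F \<rightarrow>\<^sub>E ?G" "U \<in> ?F \<rightarrow>\<^sub>E ?G"
      using V \<open>is_up_U S P c D n U\<close> by (auto simp: is_up_U_def)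
    fix f assume f: "f \<in> ?F"
    have "V f \<in> ?G" "(\<lambda>s. c n * ?D (V f) s) = ?B f"
      using V f unfolding is_up_U_def by blast+
    then show "V f = U f"
      by (rule un[OF _ conjunct1[OF U[OF f]] trans[OF _ conjunct2[OF U[OF f], symmetric]]])
  qed
  ultimately show ?thesis by blast
qed

end

theory Submission
  imports Defs
begin

text \<open>
  By (L3), the lift of \<open>f \<in> C(S n)\<close> to level \<open>m\<close> along the down-operators is uniformly close to
  \<open>(K n f) \<circ> \<iota>\<close>. The intertwining (A5) turns \<open>k\<close> steps of the chain on level \<open>m\<close>, applied to this
  lift, into the lift of \<open>(I + A n / c m)\<^sup>k f\<close>, and with \<open>k = \<lfloor>c m * t\<rfloor>\<close> this Euler scheme converges
  to the exponential of \<open>t A n\<close> applied to \<open>f\<close>. Since chain steps and down-operators are sup-norm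
  contractions and the images of the levels fill the limit space (L1), (ii) follows; (i) is its
  derivative at \<open>t = 0\<close>. For (iii), apply (i) to the indicator of \<open>s\<close>, write \<open>A\<close> through the
  up-operator, and use \<open>K (n + 1) \<circ> D (n + 1) = K n\<close>.
\<close>

section \<open>Linear operators and the Euler scheme for the exponential\<close>

text \<open>The analytic lemmas take \<open>L\<close> linear on \<open>CF UNIV\<close>, so that no
  membership conditions appear. This fits \<open>chain_A\<close>, whose formula is linear in
  arbitrary functions.\<close>

lemma CF_UNIV [simp]: "f \<in> CF UNIV"
  by (simp add: CF_def)

lemma CF_lincomb:
  assumes "f \<in> CF Z" "g \<in> CF Z"
  shows "(\<lambda>s. a * f s + b * g s) \<in> CF Z"
  using assms by (simp add: CF_def)

lemma CF_sum:
  assumes "\<And>i. i \<in> I \<Longrightarrow> g i \<in> CF Z"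
  shows "(\<lambda>s. \<Sum>i\<in>I. a i * g i s) \<in> CF Z"
  using assms by (simp add: CF_def)

lemma linear_op_onD:
  assumes "linear_op_on Z L" "f \<in> CF Z" "g \<in> CF Z"
  shows "L (\<lambda>s. a * f s + b * g s) = (\<lambda>s. a * L f s + b * L g s)"
  using assms by (auto simp: linear_op_on_def)

lemma linear_op_on_scale:
  assumes "linear_op_on Z L" "f \<in> CF Z"
  shows "L (\<lambda>s. a * f s) = (\<lambda>s. a * L f s)"
  using linear_op_onD[OF assms assms(2), of a 0] by simp

lemma linear_op_on_sum:
  assumes "linear_op_on Z L" "finite I" "\<And>i. i \<in> I \<Longrightarrow> g i \<in> CF Z"
  shows "L (\<lambda>s. \<Sum>i\<in>I. a i * g i s) = (\<lambda>s. \<Sum>i\<in>I. a i * L (g i) s)"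
  using assms(2,3)
proof (induction I rule: finite_induct)
  case empty
  show ?case
    using linear_op_on_scale[OF assms(1), of "\<lambda>_. 0" 0] by (simp add: CF_def)
next
  case (insert i I)
  have "L (\<lambda>s. a i * g i s + 1 * (\<Sum>i\<in>I. a i * g i s)) =
        (\<lambda>s. a i * L (g i) s + 1 * L (\<lambda>s. \<Sum>i\<in>I. a i * g i s) s)"
    using insert.prems by (intro linear_op_onD[OF assms(1)] CF_sum) auto
  then show ?case
    using insert by simp
qed

text \<open>Scalars pull out of powers of \<open>L\<close>. In this form the exponential is a power
  series in \<open>t\<close>, ready to be differentiated at 0.\<close>

lemma op_exp_scale:
  assumes "linear_op_on UNIV L"
  shows "op_exp (\<lambda>g s. t * L g s) f s = (\<Sum>k. (L ^^ k) f s / fact k * t ^ k)"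
proof -
  have "((\<lambda>g s. t * L g s) ^^ k) f = (\<lambda>s. t ^ k * (L ^^ k) f s)" for k
    by (induction k) (auto simp: linear_op_on_scale[OF assms])
  then show ?thesis
    by (simp add: op_exp_def mult.commute)
qed

text \<open>This is the binomial theorem for the commuting operators identity and
  \<open>x * L\<close>; the induction rests on Pascal's rule.\<close>

lemma euler_step_power:
  assumes "linear_op_on UNIV L"
  shows "((\<lambda>g s. g s + x * L g s) ^^ k) f =
         (\<lambda>s. \<Sum>j\<le>k. (real (k choose j) * x ^ j) * (L ^^ j) f s)"
proof (induction k)
  case 0
  show ?case by simp
next
  case (Suc k)
  let ?a = "\<lambda>j. real (k choose j) * x ^ j"
  have "((\<lambda>g s. g s + x * L g s) ^^ Suc k) f s =
        (\<Sum>j\<le>Suc k. (real (Suc k choose j) * x ^ j) * (L ^^ j) f s)" for s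
  proof -
    have "((\<lambda>g s. g s + x * L g s) ^^ Suc k) f s =
          (\<Sum>j\<le>k. ?a j * (L ^^ j) f s) + x * (\<Sum>j\<le>k. ?a j * (L ^^ Suc j) f s)"
      by (simp add: Suc linear_op_on_sum[OF assms])
    \<comment> \<open>The added summand vanishes because \<open>k choose Suc k\<close> is 0. After
      an index shift the two sums run over the same powers of \<open>L\<close>, and Pascal's rule
      merges them.\<close>
    also have "(\<Sum>j\<le>k. ?a j * (L ^^ j) f s) = (\<Sum>j\<le>Suc k. ?a j * (L ^^ j) f s)"
      by simp
    also have "\<dots> = f s + (\<Sum>j\<le>k. ?a (Suc j) * (L ^^ Suc j) f s)"
      by (subst sum.atMost_Suc_shift) simp
    also have "\<dots> + x * (\<Sum>j\<le>k. ?a j * (L ^^ Suc j) f s) =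
        f s + (\<Sum>j\<le>k. (real (Suc k choose Suc j) * x ^ Suc j) * (L ^^ Suc j) f s)"
      by (simp add: sum_distrib_left sum.distrib[symmetric] algebra_simps)
    also have "\<dots> = (\<Sum>j\<le>Suc k. (real (Suc k choose j) * x ^ j) * (L ^^ j) f s)"
      by (simp only: sum.atMost_Suc_shift) simp
    finally show ?thesis .
  qed
  then show ?case by blast
qed

text \<open>With \<open>k\<close> steps of size \<open>x\<close>, the left side is the product of
  \<open>k * x - i * x\<close> over \<open>i < j\<close>, divided by \<open>fact j\<close>. Here
  \<open>x = 1 / c m\<close> tends to 0 and \<open>k * x\<close> lies within \<open>x\<close> of
  \<open>t\<close>, so each of the \<open>j\<close> factors tends to \<open>t\<close>.\<close>

lemma binomial_scaled_tendsto:
  fixes c :: "nat \<Rightarrow> real"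
  assumes c: "filterlim c at_top sequentially" and t: "0 \<le> t"
  shows "(\<lambda>m. real (nat \<lfloor>c m * t\<rfloor> choose j) * (1 / c m) ^ j) \<longlonglongrightarrow> t ^ j / fact j"
proof -
  have inv: "(\<lambda>m. 1 / c m) \<longlonglongrightarrow> 0"
    using tendsto_inverse_0_at_top[OF c] by (simp add: inverse_eq_divide)
  have pos: "eventually (\<lambda>m. c m > 0) sequentially"
    using c by (simp add: filterlim_at_top_dense)
  have k: "(\<lambda>m. real (nat \<lfloor>c m * t\<rfloor>) * (1 / c m)) \<longlonglongrightarrow> t"
  proof (rule real_tendsto_sandwich[of "\<lambda>m. t - 1 / c m" _ _ "\<lambda>_. t"])
    show "eventually (\<lambda>m. t - 1 / c m \<le> real (nat \<lfloor>c m * t\<rfloor>) * (1 / c m)) sequentially"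
      using pos
    proof eventually_elim
      case (elim m)
      have "c m * t - 1 \<le> real (nat \<lfloor>c m * t\<rfloor>)"
        by linarith
      then have "(c m * t - 1) / c m \<le> real (nat \<lfloor>c m * t\<rfloor>) / c m"
        using elim by (intro divide_right_mono) auto
      then show ?case using elim by (simp add: diff_divide_distrib)
    qed
    show "eventually (\<lambda>m. real (nat \<lfloor>c m * t\<rfloor>) * (1 / c m) \<le> t) sequentially"
      using pos
    proof eventually_elim
      case (elim m)
      then have "real (nat \<lfloor>c m * t\<rfloor>) \<le> c m * t"
        using t by (simp add: of_nat_nat)
      then show ?case using elim by (simp add: field_simps)
    qed
    show "(\<lambda>m. t - 1 / c m) \<longlonglongrightarrow> t"
      using tendsto_diff[OF tendsto_const inv, of t] by simp
  qed simp
  have "(\<lambda>m. (\<Prod>i=0..<j. (real (nat \<lfloor>c m * t\<rfloor>) * (1 / c m) - real i * (1 / c m))) / fact j)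
          \<longlonglongrightarrow> (\<Prod>i=0..<j. (t - real i * 0)) / fact j"
    by (intro tendsto_intros k inv) simp
  moreover have "(\<Prod>i=0..<j. (real k * x - real i * x)) / fact j = real (k choose j) * x ^ j"
    for k x
    by (simp add: binomial_gbinomial gbinomial_prod_rev left_diff_distrib[symmetric]
        prod.distrib)
  ultimately show ?thesis
    by (simp only: mult_zero_right diff_zero prod_constant card_atLeastLessThan)
qed

text \<open>Dominated convergence for series (Tannery's theorem): the binomial terms converge one by
  one, and the \<open>j\<close>-th is at most \<open>(t * B) ^ j / fact j * M\<close>, uniformly in
  \<open>m\<close>.\<close>

lemma euler_tendsto_op_exp:
  fixes c :: "nat \<Rightarrow> real"
  assumes L: "linear_op_on UNIV L"
    and c: "filterlim c at_top sequentially" "\<And>m. 0 < c m" and t: "0 \<le> t"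
    and bound: "\<And>j. \<bar>(L ^^ j) f s\<bar> \<le> B ^ j * M"
  shows "(\<lambda>m. ((\<lambda>g s. g s + 1 / c m * L g s) ^^ nat \<lfloor>c m * t\<rfloor>) f s)
           \<longlonglongrightarrow> op_exp (\<lambda>g s. t * L g s) f s"
proof -
  define a where
    "a = (\<lambda>j m. real (nat \<lfloor>c m * t\<rfloor> choose j) * (1 / c m) ^ j * (L ^^ j) f s)"
  have lim: "(\<lambda>m. a j m) \<longlonglongrightarrow> t ^ j / fact j * (L ^^ j) f s" for j
    unfolding a_def by (intro tendsto_mult binomial_scaled_tendsto c t tendsto_const)
  have le: "norm (a j m) \<le> (t * B) ^ j / fact j * M" for j m
  proof -
    let ?k = "nat \<lfloor>c m * t\<rfloor>"
    have "real (?k choose j) * fact j \<le> real ?k ^ j"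
      using binomial_fact_pow[of ?k j] by (metis of_nat_fact of_nat_le_iff of_nat_mult of_nat_power)
    also have "\<dots> \<le> (c m * t) ^ j"
      using t c(2)[of m] by (intro power_mono) (auto simp: of_nat_nat)
    finally have "real (?k choose j) \<le> (c m * t) ^ j / fact j"
      by (simp add: field_simps)
    then have "real (?k choose j) * (1 / c m) ^ j \<le> (c m * t) ^ j / fact j * (1 / c m) ^ j"
      using c(2)[of m] by (intro mult_right_mono) auto
    also have "\<dots> = t ^ j / fact j"
      using c(2)[of m] by (simp add: power_mult_distrib power_divide)
    finally have "real (?k choose j) * (1 / c m) ^ j \<le> t ^ j / fact j" .
    then have "real (?k choose j) * (1 / c m) ^ j * \<bar>(L ^^ j) f s\<bar>
                 \<le> t ^ j / fact j * (B ^ j * M)"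
      using bound[of j] t by (intro mult_mono) auto
    then show ?thesis
      using c(2)[of m] by (simp add: a_def abs_mult power_mult_distrib mult_ac)
  qed
  have "(\<lambda>m. \<Sum>j. a j m) \<longlonglongrightarrow> (\<Sum>j. t ^ j / fact j * (L ^^ j) f s)"
  proof -
    have "eventually (\<lambda>(j, m). norm (a j m) \<le> (t * B) ^ j / fact j * M)
            (at_top \<times>\<^sub>F sequentially)"
      by (intro always_eventually) (use le in auto)
    moreover have "summable (\<lambda>j. (t * B) ^ j / fact j * M)"
      using summable_exp[of "t * B"] by (intro summable_mult2) (simp add: field_simps)
    ultimately show ?thesis
      by (intro tannerys_theorem[OF lim, THEN conjunct2, THEN conjunct2]) auto
  qed
  \<comment> \<open>The series is a finite sum: the binomial coefficient is 0 once \<open>j\<close>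
    exceeds the number of steps.\<close>
  moreover have "(\<Sum>j. a j m) = ((\<lambda>g s. g s + 1 / c m * L g s) ^^ nat \<lfloor>c m * t\<rfloor>) f s" for m
    unfolding euler_step_power[OF L] a_def by (rule suminf_finite) auto
  ultimately show ?thesis
    by (simp add: op_exp_scale[OF L] mult_ac)
qed

text \<open>The growth bound makes the power series in \<open>t\<close> converge everywhere, so its
  derivative at 0 is its linear coefficient \<open>L f s\<close>.\<close>

lemma op_exp_derivative_0:
  assumes L: "linear_op_on UNIV L" and bound: "\<And>j. \<bar>(L ^^ j) f s\<bar> \<le> B ^ j * M"
  shows "((\<lambda>t. (op_exp (\<lambda>g s. t * L g s) f s - f s) / t) \<longlongrightarrow> L f s) (at_right 0)"
proof -
  let ?a = "\<lambda>k. (L ^^ k) f s / fact k"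
  have "summable (\<lambda>k. ?a k * y ^ k)" for y
  proof (rule summable_comparison_test')
    show "summable (\<lambda>k. (\<bar>y\<bar> * B) ^ k / fact k * M)"
      using summable_exp[of "\<bar>y\<bar> * B"] by (intro summable_mult2) (simp add: field_simps)
    show "norm (?a k * y ^ k) \<le> (\<bar>y\<bar> * B) ^ k / fact k * M" if "k \<ge> 0" for k
      using mult_left_mono[OF bound[of k], of "\<bar>y\<bar> ^ k"]
      by (simp add: abs_mult power_abs power_mult_distrib field_simps)
  qed
  from termdiffs_strong_converges_everywhere[OF this, of 0]
  have "((\<lambda>t. \<Sum>k. ?a k * t ^ k) has_field_derivative L f s) (at 0)"
    unfolding powser_zero by (simp add: diffs_def)
  then have "((\<lambda>t. ((\<Sum>k. ?a k * t ^ k) - f s) / t) \<longlongrightarrow> L f s) (at 0)"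
    unfolding DERIV_def add_0 powser_zero by simp
  then show ?thesis
    unfolding op_exp_scale[OF L] by (rule filterlim_mono) (auto simp: at_le)
qed

section \<open>The chains on the levels\<close>

text \<open>Each row is a probability vector, so the sum is an average. All sup-norm contraction
  estimates for chains and down-operators come from here.\<close>

lemma stochastic_bound:
  assumes "stochastic Z Z' \<mu>" "x \<in> Z" "\<And>y. y \<in> Z' \<Longrightarrow> \<bar>f y\<bar> \<le> M"
  shows "\<bar>\<Sum>y\<in>Z'. \<mu> x y * f y\<bar> \<le> M"
proof -
  have "\<bar>\<Sum>y\<in>Z'. \<mu> x y * f y\<bar> \<le> (\<Sum>y\<in>Z'. \<mu> x y * M)"
    using assms by (intro order_trans[OF sum_abs] sum_mono)
      (auto simp: abs_mult stochastic_def intro!: mult_left_mono)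
  also have "\<dots> = M"
    using assms by (simp add: sum_distrib_right[symmetric] stochastic_def)
  finally show ?thesis .
qed

lemma linear_matrix_op: "linear_op_on Z'' (matrix_op Z Z' \<mu>)"
  by (auto simp: linear_op_on_def matrix_op_def restr_def fun_eq_iff sum.distrib
      sum_distrib_left algebra_simps)

lemma matrix_op_in_CF: "matrix_op Z Z' \<mu> f \<in> CF Z"
  by (simp add: CF_def matrix_op_def restr_def)

lemma linear_chain_A: "linear_op_on Z (chain_A S P c n)"
  unfolding linear_op_on_def chain_A_def chain_T_def
  by (auto simp: linear_op_onD[OF linear_matrix_op[of UNIV]] algebra_simps)

lemma chain_A_in_CF: "f \<in> CF (S n) \<Longrightarrow> chain_A S P c n f \<in> CF (S n)"
  by (simp add: CF_def chain_A_def chain_T_def matrix_op_def restr_def)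

lemma chain_T_power_bound:
  assumes "stochastic (S n) (S n) (P n)" "\<And>s. s \<in> S n \<Longrightarrow> \<bar>f s\<bar> \<le> M" "s \<in> S n"
  shows "\<bar>(chain_T S P n ^^ k) f s\<bar> \<le> M"
  using assms(3)
proof (induction k arbitrary: s)
  case 0
  then show ?case using assms(2) by simp
next
  case (Suc k)
  then show ?case
    using stochastic_bound[OF assms(1)]
    by (simp add: chain_T_def matrix_op_def restr_def)
qed

lemma chain_T_power_diff:
  "(chain_T S P n ^^ k) f s - (chain_T S P n ^^ k) g s = (chain_T S P n ^^ k) (\<lambda>s. f s - g s) s"
proof -
  have "(chain_T S P n ^^ k) (\<lambda>s. f s - g s) =
        (\<lambda>s. (chain_T S P n ^^ k) f s - (chain_T S P n ^^ k) g s)"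
  proof (induction k)
    case (Suc k)
    then show ?case
      using linear_op_onD[OF linear_matrix_op[of UNIV],
          of "(chain_T S P n ^^ k) f" "(chain_T S P n ^^ k) g" "S n" "S n" "P n" 1 "-1"]
      by (simp add: chain_T_def)
  qed simp
  then show ?thesis by simp
qed

text \<open>As \<open>chain_T\<close> is a contraction, \<open>chain_A\<close> has norm at most
  \<open>2 * c n\<close>. This supplies the geometric growth bound required for the exponential
  series.\<close>

lemma chain_A_power_bound:
  assumes "stochastic (S n) (S n) (P n)" "0 < c n" "\<And>s. \<bar>f s\<bar> \<le> M"
  shows "\<bar>(chain_A S P c n ^^ j) f s\<bar> \<le> (2 * c n) ^ j * M"
proof (induction j arbitrary: s)
  case 0
  then show ?case using assms(3) by simp
next
  case (Suc j)
  let ?g = "(chain_A S P c n ^^ j) f" and ?N = "(2 * c n) ^ j * M"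
  \<comment> \<open>Nonnegativity covers the points off \<open>S n\<close>, where
    \<open>chain_T\<close> returns 0; the induction hypothesis at an arbitrary point gives
    it.\<close>
  have "0 \<le> ?N"
    using Suc[of undefined] by (rule order_trans[OF abs_ge_zero])
  then have "\<bar>chain_T S P n ?g s\<bar> \<le> ?N"
    using stochastic_bound[OF assms(1), of s ?g ?N] Suc
    by (simp add: chain_T_def matrix_op_def restr_def)
  then have "\<bar>chain_T S P n ?g s - ?g s\<bar> \<le> 2 * ?N"
    using Suc[of s] by linarith
  then have "c n * \<bar>chain_T S P n ?g s - ?g s\<bar> \<le> c n * (2 * ?N)"
    using assms(2) by (intro mult_left_mono) auto
  moreover have "(chain_A S P c n ^^ Suc j) f s = c n * (chain_T S P n ?g s - ?g s)"
    by (simp add: chain_A_def[of S P c n ?g])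
  ultimately show ?case
    using assms(2) by (simp add: abs_mult mult_ac)
qed

lemma CF_bounded:
  assumes "finite Z" "f \<in> CF Z"
  obtains M where "\<And>s. \<bar>f s\<bar> \<le> M"
proof
  fix s
  have "\<bar>f s\<bar> \<le> (\<Sum>r\<in>Z. \<bar>f r\<bar>)" if "s \<in> Z"
    using assms(1) that by (intro member_le_sum) auto
  moreover have "\<bar>f s\<bar> \<le> (\<Sum>r\<in>Z. \<bar>f r\<bar>)" if "s \<notin> Z"
    using assms(2) that by (simp add: CF_def sum_nonneg)
  ultimately show "\<bar>f s\<bar> \<le> (\<Sum>r\<in>Z. \<bar>f r\<bar>)" by blast
qed

lemma CF_expand:
  assumes "finite Z" "f \<in> CF Z"
  shows "f = (\<lambda>s. \<Sum>r\<in>Z. f r * indicat_real {r} s)"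
proof
  fix s
  have "(\<Sum>r\<in>Z. f r * indicat_real {r} s) = (\<Sum>r\<in>Z. if r = s then f r else 0)"
    by (intro sum.cong) (auto simp: indicator_def)
  then show "f s = (\<Sum>r\<in>Z. f r * indicat_real {r} s)"
    using assms by (simp add: CF_def)
qed

lemma indicator_in_CF: "s \<in> Z \<Longrightarrow> indicat_real {s} \<in> CF Z"
  by (auto simp: CF_def indicator_def)

lemma lev_eq:
  assumes "disjoint_family S" "s \<in> S n"
  shows "lev S s = n"
  unfolding lev_def using assms by (intro the_equality) (auto simp: disjoint_family_on_def)

lemma transition_operator_CF:
  assumes "transition_operator Z Z' L"
  shows "linear_op_on Z' L"
    and "f \<in> CF Z' \<Longrightarrow> L f \<in> CF Z"
    and "f \<in> CF Z' \<Longrightarrow> (\<And>s. \<bar>f s\<bar> \<le> M) \<Longrightarrow> \<bar>L f s\<bar> \<le> M"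
proof -
  obtain \<mu> where \<mu>: "stochastic Z Z' \<mu>" "\<And>f. f \<in> CF Z' \<Longrightarrow> L f = matrix_op Z Z' \<mu> f"
    using assms by (auto simp: transition_operator_def)
  show "linear_op_on Z' L"
    unfolding linear_op_on_def
    by (intro ballI allI) (simp only: \<mu>(2) CF_lincomb linear_op_onD[OF linear_matrix_op])
  show "L f \<in> CF Z" if "f \<in> CF Z'"
    using that by (simp add: \<mu> matrix_op_in_CF)
  show "\<bar>L f s\<bar> \<le> M" if "f \<in> CF Z'" "\<And>s. \<bar>f s\<bar> \<le> M"
    using that stochastic_bound[OF \<mu>(1), of s f M] order_trans[OF abs_ge_zero that(2)]
    by (auto simp: \<mu>(2) matrix_op_def restr_def)
qed

section \<open>The operators \<open>K_op\<close> and the sup norm on finite sets\<close>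

lemma K_op_lincomb:
  "K_op S d n (\<lambda>s. a * f s + b * g s) = a *\<^sub>R K_op S d n f + b *\<^sub>R K_op S d n g"
  by (simp add: K_op_def scaleR_add_left sum.distrib scaleR_sum_right)

lemma K_op_indicator:
  assumes "finite (S n)" "s \<in> S n"
  shows "K_op S d n (indicat_real {s}) = d s"
proof -
  have "K_op S d n (indicat_real {s}) = (\<Sum>u\<in>S n. if u = s then d u else 0)"
    unfolding K_op_def by (intro sum.cong) (auto simp: indicator_def)
  then show ?thesis using assms by simp
qed

lemma apply_bcontfun_K_op:
  "apply_bcontfun (K_op S d n f) x = (\<Sum>u\<in>S n. f u * apply_bcontfun (d u) x)"
proof -
  have "apply_bcontfun (\<Sum>u\<in>I. f u *\<^sub>R d u) x = (\<Sum>u\<in>I. f u * apply_bcontfun (d u) x)" for I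
    by (induction I rule: infinite_finite_induct) auto
  then show ?thesis by (simp add: K_op_def)
qed

text \<open>On a finite nonempty set the supremum is a maximum, hence strict bounds pass to and from
  the single points.\<close>

lemma sup_norm_less_iff:
  assumes "finite Z" "Z \<noteq> {}"
  shows "sup_norm Z f < e \<longleftrightarrow> (\<forall>s\<in>Z. \<bar>f s\<bar> < e)"
  unfolding sup_norm_def using assms by (subst cSup_eq_Max) auto

lemma sup_norm_nonneg:
  assumes "finite Z" "Z \<noteq> {}"
  shows "0 \<le> sup_norm Z f"
proof (rule ccontr)
  assume "\<not> 0 \<le> sup_norm Z f"
  then have "sup_norm Z f < 0" by simp
  then have "\<forall>s\<in>Z. \<bar>f s\<bar> < 0"
    by (simp only: sup_norm_less_iff[OF assms])
  with assms(2) show False by auto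
qed

section \<open>Passage to the limit space\<close>

locale down_system =
  fixes S :: "nat \<Rightarrow> 's set"
    and P :: "nat \<Rightarrow> 's \<Rightarrow> 's \<Rightarrow> real"
    and c :: "nat \<Rightarrow> real"
    and D :: "nat \<Rightarrow> ('s \<Rightarrow> real) \<Rightarrow> 's \<Rightarrow> real"
    and \<iota> :: "'s \<Rightarrow> 'e::metric_space"
    and dlim :: "'s \<Rightarrow> ('e \<Rightarrow>\<^sub>C real)"
  assumes finite_S: "finite (S n)"
    and disjoint_S: "disjoint_family S"
    and stochastic_P: "stochastic (S n) (S n) (P n)"
    and c_pos: "0 < c n"
    and transition_D: "transition_operator (S (Suc n)) (S n) (D (Suc n))"
    and intertwine: "f \<in> CF (S n) \<Longrightarrow>
          chain_A S P c (Suc n) (D (Suc n) f) = D (Suc n) (chain_A S P c n f)"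
    and dense: "\<exists>s. (\<forall>n. s n \<in> S n) \<and> (\<lambda>n. \<iota> (s n)) \<longlonglongrightarrow> x"
    and d_fun_lim: "s \<in> (\<Union>n. S n) \<Longrightarrow>
          (\<lambda>n. sup_norm (S n) (\<lambda>u. d_fun S D s u - apply_bcontfun (dlim s) (\<iota> u)))
            \<longlonglongrightarrow> 0"
    and c_lim: "filterlim c at_top sequentially"
begin

abbreviation "A \<equiv> chain_A S P c"
abbreviation "T \<equiv> chain_T S P"
abbreviation "K \<equiv> K_op S dlim"

text \<open>The limit space has a point, and a sequence approximating it by (L1) visits every
  level.\<close>

lemma S_nonempty: "S n \<noteq> {}"
  using dense by blast

lemmas A_in_CF = chain_A_in_CF[where S = S and P = P and c = c]
lemmas D_linear = transition_operator_CF(1)[OF transition_D]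
lemmas D_in_CF = transition_operator_CF(2)[OF transition_D]
lemmas D_bound = transition_operator_CF(3)[OF transition_D]

section \<open>Iterated down-operators and their intertwining with the chains\<close>

lemma D_comp_in_CF: "f \<in> CF (S n) \<Longrightarrow> D_comp D n j f \<in> CF (S (n + j))"
  by (induction j) (simp_all add: D_in_CF)

lemma D_comp_linear: "linear_op_on (S n) (D_comp D n j)"
proof (induction j)
  case (Suc j)
  show ?case
    unfolding linear_op_on_def D_comp.simps
    by (intro ballI allI) (simp only: linear_op_onD[OF Suc] linear_op_onD[OF D_linear] D_comp_in_CF)
qed (simp add: linear_op_on_def)

lemma D_comp_bound:
  assumes "f \<in> CF (S n)" "\<And>s. \<bar>f s\<bar> \<le> M"
  shows "\<bar>D_comp D n j f u\<bar> \<le> M"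
proof (induction j arbitrary: u)
  case 0
  show ?case using assms(2) by simp
next
  case (Suc j)
  then show ?case
    using D_bound[OF D_comp_in_CF[OF assms(1)]] by simp
qed

text \<open>\<open>D_comp\<close> is defined by splitting off the last down-operator; here the first
  is split off, so that lifts from levels \<open>n\<close> and \<open>Suc n\<close> can be
  compared.\<close>

lemma D_comp_Suc_left: "D_comp D (Suc n) j (D (Suc n) f) = D_comp D n (Suc j) f"
  by (induction j) auto

text \<open>Expanding \<open>f\<close> in indicators reduces its lift to the finitely many functions
  \<open>d_fun S D s\<close>, to which (L3) applies.\<close>

lemma D_comp_expand:
  assumes "f \<in> CF (S n)" "u \<in> S (n + j)"
  shows "D_comp D n j f u = (\<Sum>s\<in>S n. f s * d_fun S D s u)"
proof -
  have "D_comp D n j f = D_comp D n j (\<lambda>u. \<Sum>s\<in>S n. f s * indicat_real {s} u)"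
    by (rule arg_cong[OF CF_expand[OF finite_S assms(1)]])
  also have "\<dots> = (\<lambda>u. \<Sum>s\<in>S n. f s * D_comp D n j (indicat_real {s}) u)"
    by (intro linear_op_on_sum[OF D_comp_linear] finite_S indicator_in_CF)
  finally show ?thesis
    using assms(2) by (simp add: d_fun_def lev_eq[OF disjoint_S])
qed

lemma A_D_comp:
  "f \<in> CF (S n) \<Longrightarrow> A (n + j) (D_comp D n j f) = D_comp D n j (A n f)"
proof (induction j)
  case (Suc j)
  then show ?case
    using intertwine[OF D_comp_in_CF[of f n j]] by simp
qed simp

lemma euler_in_CF:
  assumes "f \<in> CF (S n)"
  shows "((\<lambda>g s. g s + x * A n g s) ^^ k) f \<in> CF (S n)"
proof (induction k)
  case (Suc k)
  show ?case
    using CF_lincomb[OF Suc A_in_CF[OF Suc],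
        where a = 1 and b = x] by simp
qed (simp add: assms)

text \<open>A chain step is \<open>I + A / c\<close> on its own level. The intertwining moves it
  through the lift, where it becomes an Euler step for the fixed operator \<open>A n\<close> with
  the small step size \<open>1 / c (n + j)\<close>.\<close>

lemma T_power_D_comp:
  assumes "f \<in> CF (S n)"
  shows "(T (n + j) ^^ k) (D_comp D n j f) =
         D_comp D n j (((\<lambda>g s. g s + 1 / c (n + j) * A n g s) ^^ k) f)"
proof (induction k)
  case (Suc k)
  let ?g = "((\<lambda>g s. g s + 1 / c (n + j) * A n g s) ^^ k) f"
  have g: "?g \<in> CF (S n)"
    by (rule euler_in_CF[OF assms])
  have "T (n + j) h = (\<lambda>s. h s + 1 / c (n + j) * A (n + j) h s)" for h
    using c_pos[of "n + j"] by (simp add: chain_A_def)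
  then have "T (n + j) (D_comp D n j ?g) =
        (\<lambda>s. D_comp D n j ?g s + 1 / c (n + j) * D_comp D n j (A n ?g) s)"
    by (simp only: A_D_comp[OF g])
  also have "\<dots> = D_comp D n j (\<lambda>s. ?g s + 1 / c (n + j) * A n ?g s)"
    using linear_op_onD[OF D_comp_linear g A_in_CF[OF g], of j 1 "1 / c (n + j)"] by simp
  finally show ?case
    by (simp add: Suc)
qed simp

section \<open>Uniform convergence to zero along the levels\<close>

definition unif_null :: "(nat \<Rightarrow> 's \<Rightarrow> real) \<Rightarrow> bool" where
  "unif_null F \<longleftrightarrow> (\<forall>e>0. eventually (\<lambda>m. \<forall>s\<in>S m. \<bar>F m s\<bar> < e) sequentially)"

text \<open>Links the pointwise epsilon form, in which errors are easily added and scaled, to the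
  sup norms in (L3) and in the limiting semigroup.\<close>

lemma unif_null_iff_sup_norm: "unif_null F \<longleftrightarrow> (\<lambda>m. sup_norm (S m) (F m)) \<longlonglongrightarrow> 0"
  using sup_norm_nonneg[OF finite_S S_nonempty]
  by (simp add: unif_null_def tendsto_iff sup_norm_less_iff[OF finite_S S_nonempty])

lemma unif_null_add:
  assumes "unif_null F" "unif_null G"
  shows "unif_null (\<lambda>m s. F m s + G m s)"
  unfolding unif_null_def
proof (intro allI impI)
  fix e :: real assume "e > 0"
  then have "eventually (\<lambda>m. \<forall>s\<in>S m. \<bar>F m s\<bar> < e / 2) sequentially"
    "eventually (\<lambda>m. \<forall>s\<in>S m. \<bar>G m s\<bar> < e / 2) sequentially"
    using assms half_gt_zero[OF \<open>e > 0\<close>] unfolding unif_null_def by blast+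
  then show "eventually (\<lambda>m. \<forall>s\<in>S m. \<bar>F m s + G m s\<bar> < e) sequentially"
    by eventually_elim (smt (verit) field_sum_of_halves)
qed

lemma unif_null_scale:
  assumes "unif_null F"
  shows "unif_null (\<lambda>m s. a * F m s)"
  unfolding unif_null_def
proof (intro allI impI)
  fix e :: real assume "e > 0"
  then have "eventually (\<lambda>m. \<forall>s\<in>S m. \<bar>F m s\<bar> < e / (\<bar>a\<bar> + 1)) sequentially"
    using assms by (simp add: unif_null_def)
  then show "eventually (\<lambda>m. \<forall>s\<in>S m. \<bar>a * F m s\<bar> < e) sequentially"
  proof eventually_elim
    case (elim m)
    show ?case
    proof
      fix s assume "s \<in> S m"
      then have "\<bar>F m s\<bar> * (\<bar>a\<bar> + 1) < e"
        using elim by (simp add: field_simps)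
      moreover have "\<bar>a * F m s\<bar> \<le> \<bar>F m s\<bar> * (\<bar>a\<bar> + 1)"
        by (simp add: abs_mult algebra_simps)
      ultimately show "\<bar>a * F m s\<bar> < e" by linarith
    qed
  qed
qed

lemma unif_null_sum:
  assumes "\<And>i. i \<in> I \<Longrightarrow> unif_null (F i)"
  shows "unif_null (\<lambda>m s. \<Sum>i\<in>I. F i m s)"
  using assms
  by (induction I rule: infinite_finite_induct)
    (simp_all add: unif_null_add, simp_all add: unif_null_def)

lemma unif_null_cong:
  assumes "unif_null F" "\<And>m s. N \<le> m \<Longrightarrow> s \<in> S m \<Longrightarrow> G m s = F m s"
  shows "unif_null G"
  unfolding unif_null_def
proof (intro allI impI)
  fix e :: real assume "e > 0"
  then have "eventually (\<lambda>m. \<forall>s\<in>S m. \<bar>F m s\<bar> < e) sequentially"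
    using assms(1) by (simp add: unif_null_def)
  then show "eventually (\<lambda>m. \<forall>s\<in>S m. \<bar>G m s\<bar> < e) sequentially"
    using eventually_ge_at_top[of N] by eventually_elim (simp add: assms(2))
qed

text \<open>Contractivity gives a bound independent of the number of steps, so \<open>k m\<close>
  may grow with \<open>m\<close> in any way.\<close>

lemma unif_null_T_power:
  assumes "unif_null F"
  shows "unif_null (\<lambda>m. (T m ^^ k m) (F m))"
  unfolding unif_null_def
proof (intro allI impI)
  fix e :: real assume "e > 0"
  \<comment> \<open>The contraction estimate yields only a weak inequality; halving \<open>e\<close>
    restores the strict one.\<close>
  then have "eventually (\<lambda>m. \<forall>s\<in>S m. \<bar>F m s\<bar> < e / 2) sequentially"
    using assms half_gt_zero[OF \<open>e > 0\<close>] unfolding unif_null_def by blast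
  then show "eventually (\<lambda>m. \<forall>s\<in>S m. \<bar>(T m ^^ k m) (F m) s\<bar> < e) sequentially"
  proof eventually_elim
    case (elim m)
    then have "\<bar>(T m ^^ k m) (F m) s\<bar> \<le> e / 2" if "s \<in> S m" for s
      using that by (intro chain_T_power_bound[where S = S and P = P] stochastic_P) force+
    then show ?case using \<open>e > 0\<close> by force
  qed
qed

text \<open>By (L1) every \<open>x\<close> is a limit of images of points \<open>s n\<close> of
  level \<open>n\<close>, and continuity carries the vanishing over to \<open>x\<close>. Identities
  in the limit space are proved this way.\<close>

lemma unif_null_imp_eq_0:
  fixes h :: "'e \<Rightarrow>\<^sub>C real"
  assumes "unif_null (\<lambda>m u. apply_bcontfun h (\<iota> u))"
  shows "h = 0"
proof (rule bcontfun_eqI)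
  fix x
  obtain s where s: "\<And>n. s n \<in> S n" "(\<lambda>n. \<iota> (s n)) \<longlonglongrightarrow> x"
    using dense by blast
  have "isCont (apply_bcontfun h) x"
    using continuous_on_apply_bcontfun continuous_on_eq_continuous_at[OF open_UNIV] by blast
  then have "(\<lambda>n. apply_bcontfun h (\<iota> (s n))) \<longlonglongrightarrow> apply_bcontfun h x"
    using s(2) by (rule isCont_tendsto_compose)
  moreover have "(\<lambda>n. apply_bcontfun h (\<iota> (s n))) \<longlonglongrightarrow> 0"
    unfolding tendsto_iff
  proof (intro allI impI)
    fix e :: real assume "e > 0"
    then have "eventually (\<lambda>m. \<forall>u\<in>S m. \<bar>apply_bcontfun h (\<iota> u)\<bar> < e) sequentially"
      using assms by (simp add: unif_null_def)
    then show "eventually (\<lambda>n. dist (apply_bcontfun h (\<iota> (s n))) 0 < e) sequentially"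
      by eventually_elim (simp add: s(1))
  qed
  ultimately show "apply_bcontfun h x = apply_bcontfun 0 x"
    using LIMSEQ_unique by fastforce
qed

lemma unif_null_D_comp_K:
  assumes "f \<in> CF (S n)"
  shows "unif_null (\<lambda>m u. D_comp D n (m - n) f u - apply_bcontfun (K n f) (\<iota> u))"
proof (rule unif_null_cong[where N = n])
  show "unif_null (\<lambda>m u. \<Sum>s\<in>S n. f s * (d_fun S D s u - apply_bcontfun (dlim s) (\<iota> u)))"
  proof (intro unif_null_sum unif_null_scale)
    fix s assume "s \<in> S n"
    then show "unif_null (\<lambda>m u. d_fun S D s u - apply_bcontfun (dlim s) (\<iota> u))"
      unfolding unif_null_iff_sup_norm by (intro d_fun_lim) auto
  qed
  show "D_comp D n (m - n) f u - apply_bcontfun (K n f) (\<iota> u) =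
        (\<Sum>s\<in>S n. f s * (d_fun S D s u - apply_bcontfun (dlim s) (\<iota> u)))"
    if "n \<le> m" "u \<in> S m" for m u
    using D_comp_expand[OF assms, of u "m - n"] that
    by (simp add: apply_bcontfun_K_op sum_subtractf right_diff_distrib)
qed

text \<open>Lifting \<open>f\<close> from level \<open>n\<close> agrees with lifting
  \<open>D (Suc n) f\<close> from level \<open>Suc n\<close>. Both sides are thus approximated by
  the same functions on high levels, so they coincide.\<close>

lemma K_D:
  assumes "f \<in> CF (S n)"
  shows "K (Suc n) (D (Suc n) f) = K n f"
proof -
  have "unif_null (\<lambda>m u. apply_bcontfun (K (Suc n) (D (Suc n) f) - K n f) (\<iota> u))"
  proof (rule unif_null_cong[where N = "Suc n"])
    show "unif_null (\<lambda>m u. (D_comp D n (m - n) f u - apply_bcontfun (K n f) (\<iota> u)) +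
        -1 * (D_comp D (Suc n) (m - Suc n) (D (Suc n) f) u -
              apply_bcontfun (K (Suc n) (D (Suc n) f)) (\<iota> u)))"
      by (intro unif_null_add unif_null_scale unif_null_D_comp_K D_in_CF assms)
  qed (simp add: D_comp_Suc_left Suc_diff_Suc flip: D_comp.simps(2))
  from unif_null_imp_eq_0[OF this] show ?thesis by simp
qed

section \<open>The semigroup and its generator on the range of \<open>K n\<close>\<close>

lemma A_power_bound:
  assumes "f \<in> CF (S n)"
  shows "\<exists>M. \<forall>j s. \<bar>(A n ^^ j) f s\<bar> \<le> (2 * c n) ^ j * M"
proof -
  obtain M where M: "\<And>s. \<bar>f s\<bar> \<le> M"
    using CF_bounded[OF finite_S assms] by blast
  show ?thesis
    using chain_A_power_bound[where S = S and P = P and c = c and n = n and f = f and M = M,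
        OF stochastic_P c_pos M] by blast
qed

lemma op_exp_in_CF:
  assumes "f \<in> CF (S n)"
  shows "op_exp (\<lambda>g s. t * A n g s) f \<in> CF (S n)"
proof -
  have "(A n ^^ k) f \<in> CF (S n)" for k
    by (induction k) (auto intro: chain_A_in_CF assms)
  then show ?thesis
    by (simp add: CF_def op_exp_scale[OF linear_chain_A])
qed

text \<open>On the fixed finite level \<open>n\<close> pointwise convergence is uniform, and the
  lifts do not increase the sup norm.\<close>

lemma unif_null_D_comp:
  assumes g: "\<And>m. g m \<in> CF (S n)" and lim: "\<And>s. (\<lambda>m. g m s) \<longlonglongrightarrow> 0"
  shows "unif_null (\<lambda>m. D_comp D n (m - n) (g m))"
  unfolding unif_null_def
proof (intro allI impI)
  fix e :: real assume e: "e > 0"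
  have "eventually (\<lambda>m. \<forall>s\<in>S n. \<bar>g m s\<bar> < e / 2) sequentially"
    using tendstoD[OF lim, of "e / 2"] e by (intro eventually_ball_finite finite_S) auto
  then show "eventually (\<lambda>m. \<forall>u\<in>S m. \<bar>D_comp D n (m - n) (g m) u\<bar> < e) sequentially"
  proof eventually_elim
    case (elim m)
    have "\<bar>g m s\<bar> \<le> e / 2" for s
      using elim g[of m] e by (cases "s \<in> S n") (auto simp: CF_def less_imp_le)
    from D_comp_bound[OF g this] show ?case
      using e by (fastforce intro: order.strict_trans1[of _ "e / 2"])
  qed
qed

lemma semigroup_K:
  assumes lim: "limiting_feller_semigroup S P c \<iota> \<T>" and f: "f \<in> CF (S n)" and t: "0 \<le> t"
  shows "\<T> t (K n f) = K n (op_exp (\<lambda>g s. t * A n g s) f)"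
proof -
  let ?F = "apply_bcontfun (K n f)" and ?G = "op_exp (\<lambda>g s. t * A n g s) f"
  let ?k = "\<lambda>m. nat \<lfloor>c m * t\<rfloor>"
  let ?E = "\<lambda>m. ((\<lambda>g s. g s + 1 / c m * A n g s) ^^ ?k m) f"
  let ?R = "\<lambda>m. restr (S m) (?F \<circ> \<iota>)"
  have G: "?G \<in> CF (S n)"
    by (rule op_exp_in_CF[OF f])
  obtain M where M: "\<And>j s. \<bar>(A n ^^ j) f s\<bar> \<le> (2 * c n) ^ j * M"
    using A_power_bound[OF f] by blast
  have "unif_null (\<lambda>m u. (T m ^^ ?k m) (?R m) u - apply_bcontfun (\<T> t (K n f)) (\<iota> u))"
    using lim t unfolding unif_null_iff_sup_norm limiting_feller_semigroup_def by blast
  note semigroup_approx = unif_null_scale[OF this, of "-1"]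
  have "unif_null (\<lambda>m u. -1 * (D_comp D n (m - n) f u - ?F (\<iota> u)))"
    by (intro unif_null_scale unif_null_D_comp_K f)
  then have "unif_null (\<lambda>m u. ?R m u - D_comp D n (m - n) f u)"
    by (rule unif_null_cong[where N = 0]) (simp add: restr_def)
  note restr_approx = unif_null_T_power[OF this, of ?k]
  have "(\<lambda>m. ?E m s) \<longlonglongrightarrow> ?G s" for s
    by (intro euler_tendsto_op_exp[where f = f, OF linear_chain_A c_lim c_pos t M])
  then have lim_E: "(\<lambda>m. ?E m s - ?G s) \<longlonglongrightarrow> 0" for s
    using LIM_zero by blast
  have E_CF: "(\<lambda>s. ?E m s - ?G s) \<in> CF (S n)" for m
    using CF_lincomb[OF euler_in_CF[OF f, of "?k m" "1 / c m"] G, of 1 "-1"] by simp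
  note euler_approx = unif_null_D_comp[OF E_CF lim_E]
  \<comment> \<open>The difference telescopes into four errors: semigroup against chain, restricted
    limit function against lift under the chain, Euler scheme against exponential, and lift of
    \<open>?G\<close> against \<open>K n ?G\<close>. The middle two meet because \<open>?k m\<close>
    chain steps on the lift of \<open>f\<close> give the lift of \<open>?E m\<close>.\<close>
  have "unif_null (\<lambda>m u. apply_bcontfun (\<T> t (K n f) - K n ?G) (\<iota> u))"
  proof (rule unif_null_cong[OF unif_null_add[OF unif_null_add[OF unif_null_add[OF
        semigroup_approx restr_approx] euler_approx] unif_null_D_comp_K[OF G]], where N = n])
    fix m u assume m: "n \<le> m"
    have "(T m ^^ ?k m) (D_comp D n (m - n) f) = D_comp D n (m - n) (?E m)"
      using T_power_D_comp[OF f, of "?k m" "m - n"] m by simp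
    moreover have "D_comp D n (m - n) (\<lambda>s. ?E m s - ?G s) u =
        D_comp D n (m - n) (?E m) u - D_comp D n (m - n) ?G u"
      using linear_op_onD[OF D_comp_linear euler_in_CF[OF f, of "?k m" "1 / c m"] G,
          of "m - n" 1 "-1"] by simp
    ultimately show "apply_bcontfun (\<T> t (K n f) - K n ?G) (\<iota> u) =
        -1 * ((T m ^^ ?k m) (?R m) u - apply_bcontfun (\<T> t (K n f)) (\<iota> u)) +
        (T m ^^ ?k m) (\<lambda>u. ?R m u - D_comp D n (m - n) f u) u +
        D_comp D n (m - n) (\<lambda>s. ?E m s - ?G s) u +
        (D_comp D n (m - n) ?G u - apply_bcontfun (K n ?G) (\<iota> u))"
      by (simp flip: chain_T_power_diff)
  qed
  from unif_null_imp_eq_0[OF this] show ?thesis by simp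
qed

text \<open>By \<open>semigroup_K\<close> the difference quotient is a combination of the finitely
  many \<open>dlim u\<close> with \<open>u \<in> S n\<close>, so the limit is taken coefficient by
  coefficient.\<close>

lemma generator_K:
  assumes lim: "limiting_feller_semigroup S P c \<iota> \<T>" and f: "f \<in> CF (S n)"
  shows "((\<lambda>t. (\<T> t (K n f) - K n f) /\<^sub>R t) \<longlongrightarrow> K n (A n f)) (at_right 0)"
proof -
  let ?G = "\<lambda>t. op_exp (\<lambda>g s. t * A n g s) f"
  obtain M where M: "\<And>j s. \<bar>(A n ^^ j) f s\<bar> \<le> (2 * c n) ^ j * M"
    using A_power_bound[OF f] by blast
  have "((\<lambda>t. \<Sum>u\<in>S n. ((?G t u - f u) / t) *\<^sub>R dlim u) \<longlongrightarrow>
      (\<Sum>u\<in>S n. A n f u *\<^sub>R dlim u)) (at_right 0)"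
    by (intro tendsto_sum tendsto_scaleR tendsto_const op_exp_derivative_0[OF linear_chain_A M])
  moreover have "eventually (\<lambda>t. (\<Sum>u\<in>S n. ((?G t u - f u) / t) *\<^sub>R dlim u) =
      (\<T> t (K n f) - K n f) /\<^sub>R t) (at_right 0)"
    using eventually_at_right_less[of 0]
  proof eventually_elim
    case (elim t)
    have "(\<T> t (K n f) - K n f) /\<^sub>R t = inverse t *\<^sub>R (K n (?G t) - K n f)"
      using elim by (simp add: semigroup_K[OF lim f])
    then show ?case
      by (simp add: K_op_def scaleR_sum_right divide_inverse mult.commute
          scaleR_diff_left scaleR_diff_right right_diff_distrib sum_subtractf)
  qed
  ultimately show ?thesis
    unfolding K_op_def by (rule Lim_transform_eventually)
qed

section \<open>The generator on the functions \<open>dlim s\<close>\<close>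

lemma chain_A_root:
  assumes "S 0 = {r}" "f \<in> CF (S 0)"
  shows "A 0 f = (\<lambda>_. 0)"
  \<comment> \<open>The only entry of a stochastic matrix on a singleton is 1, so the chain at the
    root stands still.\<close>
  using assms stochastic_P[of 0]
  by (auto simp: CF_def chain_A_def chain_T_def matrix_op_def restr_def stochastic_def)

text \<open>The equation defining the up-operator is solved for \<open>A (Suc n)\<close> at the
  indicator of \<open>s\<close>. Applying \<open>K (Suc n)\<close> then removes the down-operator by
  \<open>K_D\<close>.\<close>

lemma K_A_indicator_Suc:
  assumes s: "s \<in> S (Suc n)"
    and range: "(\<lambda>f s. A (Suc n) f s + c n * f s) ` CF (S (Suc n)) \<subseteq> D (Suc n) ` CF (S n)"
    and inj: "inj_on (D (Suc n)) (CF (S n))"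
  shows "K (Suc n) (A (Suc n) (indicat_real {s})) =
         - c n *\<^sub>R (dlim s - (\<Sum>r\<in>S n. p_up S P c D n r s *\<^sub>R dlim r))"
proof -
  let ?g = "up_U S P c D n (indicat_real {s})"
  \<comment> \<open>Existence and uniqueness turn the definite description in \<open>up_U\<close>
    into an operator with the defining property.\<close>
  have "is_up_U S P c D n (up_U S P c D n)"
    unfolding up_U_def
    by (rule theI'[of "is_up_U S P c D n"], rule ex1_up_U)
      (fact finite_S c_pos transition_D range inj)+
  then have g: "?g \<in> CF (S n)"
    and eq: "(\<lambda>u. c n * D (Suc n) ?g u) =
      (\<lambda>u. A (Suc n) (indicat_real {s}) u + c n * indicat_real {s} u)"
    using indicator_in_CF[OF s] unfolding is_up_U_def by blast+
  have "A (Suc n) (indicat_real {s}) =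
      (\<lambda>u. c n * D (Suc n) ?g u + (- c n) * indicat_real {s} u)"
  proof
    fix u
    show "A (Suc n) (indicat_real {s}) u = c n * D (Suc n) ?g u + (- c n) * indicat_real {s} u"
      using fun_cong[OF eq, of u] by linarith
  qed
  then have "K (Suc n) (A (Suc n) (indicat_real {s})) = c n *\<^sub>R K n ?g + (- c n) *\<^sub>R dlim s"
    by (simp only: K_op_lincomb K_D[OF g] K_op_indicator[where S = S, OF finite_S s])
  also have "K n ?g = (\<Sum>r\<in>S n. p_up S P c D n r s *\<^sub>R dlim r)"
    by (simp add: K_op_def p_up_def)
  finally show ?thesis
    by (simp add: scaleR_diff_right)
qed

end

theorem proposition4p7:
  fixes S :: "nat \<Rightarrow> 's set"
    and root :: 's
    and P :: "nat \<Rightarrow> 's \<Rightarrow> 's \<Rightarrow> real"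
    and c :: "nat \<Rightarrow> real"
    and D :: "nat \<Rightarrow> ('s \<Rightarrow> real) \<Rightarrow> 's \<Rightarrow> real"
    and \<iota> :: "'s \<Rightarrow> 'e::metric_space"
    and dlim :: "'s \<Rightarrow> ('e \<Rightarrow>\<^sub>C real)"
    and \<T> :: "real \<Rightarrow> ('e \<Rightarrow>\<^sub>C real) \<Rightarrow> ('e \<Rightarrow>\<^sub>C real)"
  assumes A0: "\<And>n. finite (S n)" "disjoint_family S" "S 0 = {root}"
    and chain: "\<And>n. stochastic (S n) (S n) (P n)"
    and A1: "\<And>n. 0 < c n \<and> c n < c (Suc n)"
    and A2: "\<And>n. transition_operator (S (Suc n)) (S n) (D (Suc n))"
    and A3: "\<And>n. (\<lambda>f s. chain_A S P c (Suc n) f s + c n * f s) ` CF (S (Suc n))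
                  \<subseteq> D (Suc n) ` CF (S n)"
    and A4: "\<And>n. inj_on (D (Suc n)) (CF (S n))"
    and A5: "\<And>n f. f \<in> CF (S n) \<Longrightarrow>
                  chain_A S P c (Suc n) (D (Suc n) f) = D (Suc n) (chain_A S P c n f)"
    and E: "compact (UNIV :: 'e set)"
    and L1: "\<And>x. \<exists>s. (\<forall>n. s n \<in> S n) \<and> (\<lambda>n. \<iota> (s n)) \<longlonglongrightarrow> x"
    and L2: "closure (span (dlim ` (\<Union>n. S n))) = UNIV"
    and L3: "\<And>s. s \<in> (\<Union>n. S n) \<Longrightarrow>
               (\<lambda>n. sup_norm (S n) (\<lambda>u. d_fun S D s u - apply_bcontfun (dlim s) (\<iota> u)))
                 \<longlonglongrightarrow> 0"
    and c_lim: "filterlim c at_top sequentially"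
    and semigroup: "limiting_feller_semigroup S P c \<iota> \<T>"
  shows "(\<forall>n. \<forall>f\<in>CF (S n). K_op S dlim n f \<in> gen_domain \<T> \<and>
            generator \<T> (K_op S dlim n f) = K_op S dlim n (chain_A S P c n f))
       \<and> (\<forall>n. \<forall>t\<ge>0. \<forall>f\<in>CF (S n).
            \<T> t (K_op S dlim n f) =
              K_op S dlim n (op_exp (\<lambda>g s. t * chain_A S P c n g s) f))
       \<and> (\<forall>s\<in>(\<Union>n. S n). dlim s \<in> gen_domain \<T> \<and>
            generator \<T> (dlim s) =
              - rate c (int (lev S s) - 1) *\<^sub>R
                (dlim s - (\<Sum>r\<in>{r \<in> (\<Union>n. S n). int (lev S r) = int (lev S s) - 1}.
                             p_up S P c D (lev S r) r s *\<^sub>R dlim r)))"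
proof -
  have c_pos: "0 < c n" for n
    using A1 by blast
  interpret down_system S P c D \<iota> dlim
    by unfold_locales (fact A0(1) A0(2) chain c_pos A2 A5 L1 L3 c_lim)+
  have gen: "K_op S dlim n f \<in> gen_domain \<T> \<and>
      generator \<T> (K_op S dlim n f) = K_op S dlim n (chain_A S P c n f)"
    if "f \<in> CF (S n)" for n f
    using generator_K[OF semigroup that] unfolding gen_domain_def generator_def
    by (auto intro: tendsto_Lim)
  have "dlim s \<in> gen_domain \<T> \<and> generator \<T> (dlim s) =
      - rate c (int (lev S s) - 1) *\<^sub>R
        (dlim s - (\<Sum>r\<in>{r \<in> (\<Union>n. S n). int (lev S r) = int (lev S s) - 1}.
                     p_up S P c D (lev S r) r s *\<^sub>R dlim r))"
    if s: "s \<in> S n" for s n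
  proof -
    note lev = lev_eq[OF A0(2)]
    \<comment> \<open>\<open>dlim s\<close> is the image under \<open>K_op\<close> of the indicator
      of \<open>s\<close>, so the generator formula on the range of \<open>K_op\<close>
      applies.\<close>
    have dlim: "dlim s \<in> gen_domain \<T>"
      "generator \<T> (dlim s) = K_op S dlim n (chain_A S P c n (indicat_real {s}))"
      using gen[OF indicator_in_CF[OF s]] by (simp_all add: K_op_indicator[where S = S, OF A0(1) s])
    show ?thesis
    proof (cases n)
      case 0
      \<comment> \<open>Both sides are 0: the chain at the root is constant, and
        \<open>rate c\<close> at -1 is 0.\<close>
      then show ?thesis
        using dlim s chain_A_root[OF A0(3) indicator_in_CF[of s "S 0"]]
        by (simp add: lev[OF s] rate_def K_op_def)
    next
      case (Suc m)
      \<comment> \<open>Disjointness of the levels makes the index set of the sum exactly the level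
        below that of \<open>s\<close>.\<close>
      have "{r \<in> (\<Union>n. S n). int (lev S r) = int (lev S s) - 1} = S m"
        using lev[OF s] Suc by (auto simp: lev)
      then show ?thesis
        using dlim K_A_indicator_Suc[OF _ A3 A4, of s m] s
        by (simp add: lev[OF s] Suc rate_def lev cong: sum.cong)
    qed
  qed
  then show ?thesis
    using gen semigroup_K[OF semigroup] by blast
qed

end
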